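(* Let $\Gamma_1$ be a non-empty set of cycles and let $\Gamma_2$ be a (possibly empty) set of cycles of length at least $5$. Let $R_1=R(\Gamma_1,\{C_4\}\cup\Gamma_2)$ and $R_2=R(\Gamma_1,\{C_3,C_4\}\cup\Gamma_2)$. If every cycle in $\Gamma_1$ has length at least $6$, then $R_1=R_2$. In particular, $R(\{C_n\},\{C_4\})=R(\{C_n\},\{C_3,C_4\})$ whenever $n\geq 6$.
   Context: All graphs are finite, simple and undirected; $C_k$ ($k\ge 3$) is the cycle of length $k$. A red-blue graph is a complete graph with each edge coloured red or blue. For non-empty sets $\mathcal G_1,\mathcal G_2$ of non-empty graphs, $R(\mathcal G_1,\mathcal G_2)$ is the least positive integer $N$ such that each red-blue graph on $N$ vertices contains a red subgraph from $\mathcal G_1$ or a blue subgraph from $\mathcal G_2$. *)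

theory Defs
  imports "HOL-Library.Ramsey"
begin

text \<open>A graph is a pair of a vertex set and a set of two-element sets of vertices.\<close>

type_synonym 'a graph = "'a set \<times> 'a set set"

abbreviation verts :: "'a graph \<Rightarrow> 'a set"
  where "verts \<equiv> fst"

abbreviation edges :: "'a graph \<Rightarrow> 'a set set"
  where "edges \<equiv> snd"

definition simple_graph :: "'a graph \<Rightarrow> bool"
  where "simple_graph G \<longleftrightarrow> finite (verts G) \<and> edges G \<subseteq> [verts G]\<^bsup>2\<^esup>"

definition subgraph :: "'a graph \<Rightarrow> 'a graph \<Rightarrow> bool"
  where "subgraph H G \<longleftrightarrow>
    simple_graph H \<and> simple_graph G \<and> verts H \<subseteq> verts G \<and> edges H \<subseteq> edges G"

definition graph_iso :: "'a graph \<Rightarrow> 'b graph \<Rightarrow> bool"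
  where "graph_iso G H \<longleftrightarrow> simple_graph G \<and> simple_graph H \<and>
    (\<exists>f. bij_betw f (verts G) (verts H) \<and> (\<lambda>e. f ` e) ` edges G = edges H)"

text \<open>Meaningful for \<open>k \<ge> 3\<close> only.\<close>

definition cycle_graph :: "nat \<Rightarrow> nat graph"
  where "cycle_graph k = ({..<k}, {{i, Suc i mod k} | i. i < k})"

definition is_cycle :: "'a graph \<Rightarrow> bool"
  where "is_cycle G \<longleftrightarrow> (\<exists>k\<ge>3. graph_iso G (cycle_graph k))"

definition cycle_length :: "'a graph \<Rightarrow> nat"
  where "cycle_length G = card (edges G)"

text \<open>The complete graph on \<open>V\<close>, with its edges partitioned into red edges \<open>R\<close> and blue edges \<open>B\<close>.\<close>

definition red_blue_graph :: "'a set \<Rightarrow> 'a set set \<Rightarrow> 'a set set \<Rightarrow> bool"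
  where "red_blue_graph V R B \<longleftrightarrow> finite V \<and> R \<union> B = [V]\<^bsup>2\<^esup> \<and> R \<inter> B = {}"

text \<open>As usual, subgraphs from a set of graphs are meant up to isomorphism.\<close>

definition has_subgraph_from :: "'a graph \<Rightarrow> 'b graph set \<Rightarrow> bool"
  where "has_subgraph_from G \<G> \<longleftrightarrow> (\<exists>S H. subgraph S G \<and> H \<in> \<G> \<and> graph_iso S H)"

definition ramsey_property :: "'a graph set \<Rightarrow> 'b graph set \<Rightarrow> nat \<Rightarrow> bool"
  where "ramsey_property \<G>1 \<G>2 N \<longleftrightarrow>
    (\<forall>(V::nat set) R B. red_blue_graph V R B \<and> card V = N \<longrightarrow>
       has_subgraph_from (V, R) \<G>1 \<or> has_subgraph_from (V, B) \<G>2)"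

text \<open>The least number exists by Ramsey's theorem whenever both sets contain a simple graph;
  see \<open>ramsey_number_exists\<close> below.\<close>

definition ramsey_number :: "'a graph set \<Rightarrow> 'b graph set \<Rightarrow> nat"
  where "ramsey_number \<G>1 \<G>2 = (LEAST N. N > 0 \<and> ramsey_property \<G>1 \<G>2 N)"

lemma simple_graph_cycle_graph:
  assumes "k \<ge> 3"
  shows "simple_graph (cycle_graph k)"
proof -
  have "Suc i mod k \<noteq> i" if "i < k" for i
    using assms that by (cases "Suc i = k") auto
  with assms show ?thesis
    by (fastforce simp: simple_graph_def cycle_graph_def)
qed

lemma is_cycle_cycle_graph:
  assumes "k \<ge> 3"
  shows "is_cycle (cycle_graph k)"
  unfolding is_cycle_def graph_iso_def
  using assms simple_graph_cycle_graph[OF assms]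
  by (intro exI[of _ k] conjI exI[of _ id]) auto

lemma cycle_length_cycle_graph:
  assumes "k \<ge> 3"
  shows "cycle_length (cycle_graph k) = k"
proof -
  have "inj_on (\<lambda>i. {i, Suc i mod k}) {..<k}"
  proof (rule inj_onI)
    fix i j assume ij: "i \<in> {..<k}" "j \<in> {..<k}" and eq: "{i, Suc i mod k} = {j, Suc j mod k}"
    have m: "Suc i mod k = (if Suc i = k then 0 else Suc i)"
      "Suc j mod k = (if Suc j = k then 0 else Suc j)"
      using ij by auto
    show "i = j"
      using eq ij assms unfolding m by (auto simp: doubleton_eq_iff split: if_splits)
  qed
  moreover have "edges (cycle_graph k) = (\<lambda>i. {i, Suc i mod k}) ` {..<k}"
    by (auto simp: cycle_graph_def)
  ultimately show ?thesis
    by (simp add: cycle_length_def card_image)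
qed

lemma has_subgraph_from_if_complete_on:
  assumes H: "simple_graph H" "H \<in> \<G>" and G: "simple_graph G"
    and W: "W \<subseteq> verts G" "card W = card (verts H)" "[W]\<^bsup>2\<^esup> \<subseteq> edges G"
  shows "has_subgraph_from G \<G>"
proof -
  have finW: "finite W"
    using G W(1) by (auto simp: simple_graph_def intro: finite_subset)
  then obtain f where f: "bij_betw f (verts H) W"
    using H(1) W(2) by (metis simple_graph_def finite_same_card_bij)
  let ?S = "(W, (\<lambda>e. f ` e) ` edges H)"
  have sub: "(\<lambda>e. f ` e) ` edges H \<subseteq> [W]\<^bsup>2\<^esup>"
  proof
    fix d assume "d \<in> (\<lambda>e. f ` e) ` edges H"
    then obtain e where e: "e \<in> edges H" "d = f ` e" by blast
    then have "e \<in> [verts H]\<^bsup>2\<^esup>"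
      using H(1) by (auto simp: simple_graph_def)
    then obtain x y where xy: "e = {x, y}" "x \<in> verts H" "y \<in> verts H" "x \<noteq> y"
      by (rule nsets2_E)
    then have "f x \<noteq> f y" "f x \<in> W" "f y \<in> W"
      using f by (auto simp: bij_betw_def inj_on_def)
    then show "d \<in> [W]\<^bsup>2\<^esup>"
      by (simp add: e xy)
  qed
  have S: "simple_graph ?S"
    using finW sub by (simp add: simple_graph_def)
  have "subgraph ?S G"
    using S G W sub by (auto simp: subgraph_def)
  moreover have "graph_iso ?S H"
    unfolding graph_iso_def
  proof (intro conjI exI[of _ "inv_into (verts H) f"])
    show "bij_betw (inv_into (verts H) f) (verts ?S) (verts H)"
      using f by (simp add: bij_betw_inv_into)
    have *: "inv_into (verts H) f ` f ` e = e" if "e \<in> edges H" for e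
    proof (rule inv_into_image_cancel)
      show "inj_on f (verts H)"
        using f by (simp add: bij_betw_def)
      show "e \<subseteq> verts H"
        using that H(1) by (auto simp: simple_graph_def nsets_def)
    qed
    show "(\<lambda>e. inv_into (verts H) f ` e) ` edges ?S = edges H"
      using * by (simp add: image_image)
  qed (use S H in auto)
  ultimately show ?thesis
    using H(2) unfolding has_subgraph_from_def by blast
qed

lemma ramsey_number_exists:
  assumes "simple_graph H1" "H1 \<in> \<G>1" "simple_graph H2" "H2 \<in> \<G>2"
  shows "\<exists>N>0. ramsey_property \<G>1 \<G>2 N"
proof -
  obtain N where "N \<ge> 1" and N: "\<And>(V::nat set) E. finite V \<Longrightarrow> card V \<ge> N \<Longrightarrow>
      \<exists>W\<subseteq>V. card W = card (verts H1) \<and> clique W E \<or> card W = card (verts H2) \<and> indep W E"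
    using ramsey2[of "card (verts H1)" "card (verts H2)"] by metis
  have "ramsey_property \<G>1 \<G>2 N"
    unfolding ramsey_property_def
  proof (intro allI impI, elim conjE)
    fix V :: "nat set" and R B
    assume rb: "red_blue_graph V R B" and V: "card V = N"
    then have fin: "finite V" and un: "R \<union> B = [V]\<^bsup>2\<^esup>"
      by (auto simp: red_blue_graph_def)
    then have simple: "simple_graph (V, R)" "simple_graph (V, B)"
      by (auto simp: simple_graph_def)
    obtain W where W: "W \<subseteq> V"
      "card W = card (verts H1) \<and> clique W R \<or> card W = card (verts H2) \<and> indep W R"
      using N[OF fin, of R] V by auto
    then have WV: "[W]\<^bsup>2\<^esup> \<subseteq> R \<union> B"
      unfolding un by (intro nsets_mono)
    from W(2) show "has_subgraph_from (V, R) \<G>1 \<or> has_subgraph_from (V, B) \<G>2"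
    proof (elim disjE conjE)
      assume "card W = card (verts H1)" "clique W R"
      moreover from this have "[W]\<^bsup>2\<^esup> \<subseteq> R"
        by (auto simp: clique_def elim!: nsets2_E)
      ultimately show ?thesis
        using has_subgraph_from_if_complete_on[OF assms(1,2) simple(1)] W(1) by auto
    next
      assume "card W = card (verts H2)" "indep W R"
      moreover have "[W]\<^bsup>2\<^esup> \<subseteq> B"
      proof
        fix e assume e: "e \<in> [W]\<^bsup>2\<^esup>"
        then have "e \<notin> R"
          using \<open>indep W R\<close> by (auto simp: indep_def elim!: nsets2_E)
        with e WV show "e \<in> B" by blast
      qed
      ultimately show ?thesis
        using has_subgraph_from_if_complete_on[OF assms(3,4) simple(2)] W(1) by auto
    qed
  qed
  with \<open>N \<ge> 1\<close> show ?thesis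
    by (intro exI[of _ N]) auto
qed

end

theory Submission
  imports Defs
begin

text \<open>
  For every \<open>N\<close> the two Ramsey properties are equivalent. Given a colouring without red cycles
  from \<open>\<Gamma>1\<close> and without blue graphs from \<open>{C4} \<union> \<Gamma>2\<close>, choose one with as few blue edges as possible
  and suppose that it has a blue triangle \<open>a b c\<close>. By minimality, recolouring any edge of the
  triangle red creates a red cycle from \<open>\<Gamma>1\<close> through that edge. As there is no blue \<open>C4\<close>, the blue
  neighbourhoods of \<open>a\<close>, \<open>b\<close> and \<open>c\<close> outside the triangle are disjoint and joined to each other by red
  edges only. This allows the cycle through \<open>ab\<close> to be rerouted to a red cycle of the same length:
  if it misses \<open>c\<close>, then \<open>c\<close> can replace \<open>a\<close> or \<open>b\<close>; otherwise it is rearranged on its own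
  vertices, up to the case that all its vertices but one outside the triangle are blue neighbours of
  \<open>b\<close> (or of \<open>a\<close>). In that case the cycle through \<open>ca\<close> provides a second red neighbour of \<open>b\<close>.
\<close>

section \<open>Cyclic walks\<close>

lemma not_successively_split:
  assumes "\<not> successively P xs"
  obtains X u v Y where "xs = X @ u # v # Y" "\<not> P u v"
proof -
  have "\<exists>X u v Y. xs = X @ u # v # Y \<and> \<not> P u v"
    using assms
  proof (induction xs rule: induct_list012)
    case (3 x y zs)
    then show ?case
      by (metis append_Cons append_Nil successively.simps(3))
  qed auto
  then show ?thesis using that by blast
qed

text \<open>From the first entry outside \<open>P\<close> onwards, each step forces \<open>Q\<close>
  on the next entry, and \<open>Q\<close> excludes \<open>P\<close>, so \<open>P\<close> never
  returns.\<close>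

lemma successively_disj_decomp:
  assumes "successively (\<lambda>u v. P u \<or> Q v) xs" "xs \<noteq> []" "\<not> P (last xs)"
    and "\<And>u. Q u \<Longrightarrow> \<not> P u"
  obtains X x Y where "xs = X @ x # Y" "\<forall>u\<in>set X. P u" "\<not> P x" "\<forall>u\<in>set Y. Q u"
proof -
  have *: "\<forall>u\<in>set ys. Q u" if "successively (\<lambda>u v. P u \<or> Q v) (y # ys)" "\<not> P y" for y ys
    using that
  proof (induction ys arbitrary: y)
    case (Cons z zs)
    from Cons.prems have "Q z" "successively (\<lambda>u v. P u \<or> Q v) (z # zs)" by simp_all
    then have "\<forall>u\<in>set zs. Q u" using Cons.IH assms(4) by blast
    with \<open>Q z\<close> show ?case by simp
  qed simp
  have "\<exists>u\<in>set xs. \<not> P u" using assms(2,3) last_in_set by blast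
  then obtain X x Y where X: "xs = X @ x # Y" "\<not> P x" "\<forall>u\<in>set X. P u"
    using split_list_first_prop[of xs "\<lambda>u. \<not> P u"] by blast
  then have "successively (\<lambda>u v. P u \<or> Q v) (x # Y)"
    using assms(1) by (simp add: successively_append_iff)
  with X(2) have "\<forall>u\<in>set Y. Q u" using * by blast
  with X show ?thesis by (intro that)
qed

lemma successively_tl: "successively (\<lambda>u v. P v) xs \<longleftrightarrow> (\<forall>v\<in>set (tl xs). P v)"
  by (induction xs rule: induct_list012) auto

lemma successively_butlast: "successively (\<lambda>u v. P u) xs \<longleftrightarrow> (\<forall>v\<in>set (butlast xs). P v)"
  by (induction xs rule: induct_list012) auto

text \<open>Cycles are encoded as vertex lists so that rerouting becomes rearranging a list. Only
  lists of length at least 3 represent cycles.\<close>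

definition cyclic_walk :: "('a \<Rightarrow> 'a \<Rightarrow> bool) \<Rightarrow> 'a list \<Rightarrow> bool"
  where "cyclic_walk r L \<longleftrightarrow> distinct L \<and> successively r L \<and> r (last L) (hd L)"

lemma cyclic_walk_rotate:
  "cyclic_walk r (xs @ ys) \<longleftrightarrow> cyclic_walk r (ys @ xs)"
  by (cases "xs = []"; cases "ys = []") (auto simp: cyclic_walk_def successively_append_iff)

lemma cyclic_walk_rev:
  assumes "\<And>x y. r x y \<longleftrightarrow> r y x"
  shows "cyclic_walk r (rev L) \<longleftrightarrow> cyclic_walk r L"
proof -
  have r: "(\<lambda>x y. r y x) = r" using assms by (intro ext) blast
  show ?thesis
    unfolding cyclic_walk_def successively_rev r
    by (simp add: hd_rev last_rev assms[of "hd L" "last L"])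
qed

lemma cyclic_walk_conv_nth:
  assumes "L \<noteq> []"
  shows "cyclic_walk r L \<longleftrightarrow> distinct L \<and> (\<forall>i<length L. r (L ! i) (L ! (Suc i mod length L)))"
proof -
  have "(\<forall>i<length L. r (L ! i) (L ! (Suc i mod length L))) \<longleftrightarrow>
    (\<forall>i. Suc i < length L \<longrightarrow> r (L ! i) (L ! Suc i)) \<and> r (L ! (length L - 1)) (L ! 0)"
    (is "?l \<longleftrightarrow> ?r")
  proof
    assume l: ?l
    have "r (L ! i) (L ! Suc i)" if "Suc i < length L" for i
      using l[rule_format, of i] that by simp
    moreover have "r (L ! (length L - 1)) (L ! 0)"
      using l[rule_format, of "length L - 1"] assms by simp
    ultimately show ?r by blast
  next
    assume r: ?r
    show ?l
    proof (intro allI impI)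
      fix i assume "i < length L"
      then show "r (L ! i) (L ! (Suc i mod length L))"
        using r by (cases "Suc i = length L") (auto dest!: arg_cong[of "Suc i" _ "\<lambda>n. n - 1"])
    qed
  qed
  then show ?thesis
    using assms by (auto simp: cyclic_walk_def successively_conv_nth hd_conv_nth last_conv_nth)
qed

section \<open>Rerouting cycles around a blue triangle\<close>

text \<open>\<open>bl\<close> is blue adjacency and \<open>n\<close> the length of a forbidden red cycle; red pairs of vertices are the
  distinct ones that are not related by \<open>bl\<close>.\<close>

locale C4_free_triangle =
  fixes bl :: "'a \<Rightarrow> 'a \<Rightarrow> bool" and V :: "'a set" and n :: nat and a b c :: 'a
  assumes sym: "bl x y \<longleftrightarrow> bl y x"
    and irrefl [simp]: "\<not> bl x x"
    and C4_free: "bl x y \<Longrightarrow> bl y z \<Longrightarrow> bl z w \<Longrightarrow> bl w x \<Longrightarrow> x = z \<or> y = w"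
    and tri: "bl a b" "bl b c" "bl a c"
    and V: "a \<in> V" "b \<in> V" "c \<in> V"
    and no_cycle: "set L \<subseteq> V \<Longrightarrow> cyclic_walk (\<lambda>x y. \<not> bl x y) L \<Longrightarrow> length L \<noteq> n"
begin

lemma neq: "a \<noteq> b" "b \<noteq> c" "a \<noteq> c" "b \<noteq> a" "c \<noteq> b" "c \<noteq> a"
  using tri by auto

text \<open>A common blue neighbour of two triangle vertices would form a blue C4 with the triangle,
  for example \<open>a x b c\<close>.\<close>

lemma nbr_disjoint:
  assumes "x \<noteq> a" "x \<noteq> b" "x \<noteq> c"
  shows "bl a x \<Longrightarrow> \<not> bl b x" "bl a x \<Longrightarrow> \<not> bl c x" "bl b x \<Longrightarrow> \<not> bl c x"
proof -
  have rev: "bl b a" "bl c b" "bl c a" using tri sym by blast+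
  show "bl a x \<Longrightarrow> \<not> bl b x"
    using assms C4_free[of a x b c] rev(3) tri neq sym[of x b] by auto
  show "bl a x \<Longrightarrow> \<not> bl c x"
    using assms C4_free[of a x c b] rev tri neq sym[of x c] by auto
  show "bl b x \<Longrightarrow> \<not> bl c x"
    using assms C4_free[of b x c a] rev tri neq sym[of x c] by auto
qed

text \<open>A blue edge \<open>x y\<close> would close a blue C4 over an edge of the triangle, for
  example \<open>a x y b\<close>.\<close>

lemma nbr_joined:
  assumes "x \<noteq> a" "x \<noteq> b" "x \<noteq> c" "y \<noteq> a" "y \<noteq> b" "y \<noteq> c"
  shows "bl a x \<Longrightarrow> bl b y \<Longrightarrow> \<not> bl x y" "bl a x \<Longrightarrow> bl c y \<Longrightarrow> \<not> bl x y"
    "bl b x \<Longrightarrow> bl c y \<Longrightarrow> \<not> bl x y"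
proof -
  have rev: "bl b a" "bl c b" "bl c a" using tri sym by blast+
  show "bl a x \<Longrightarrow> bl b y \<Longrightarrow> \<not> bl x y"
    using assms C4_free[of a x y b] rev sym[of y b] by auto
  show "bl a x \<Longrightarrow> bl c y \<Longrightarrow> \<not> bl x y"
    using assms C4_free[of a x y c] rev sym[of y c] by auto
  show "bl b x \<Longrightarrow> bl c y \<Longrightarrow> \<not> bl x y"
    using assms C4_free[of b x y c] rev sym[of y c] by auto
qed

lemma no_walk:
  assumes "successively (\<lambda>x y. \<not> bl x y) L" "\<not> bl (last L) (hd L)" "distinct L" "set L \<subseteq> V"
    "length L = n"
  shows False
  using assms no_cycle[of L] by (simp add: cyclic_walk_def)

lemma swap: "C4_free_triangle bl V n b a c"
proof
  show "\<And>x y. bl x y = bl y x" by (rule sym)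
  show "\<And>x y z w. bl x y \<Longrightarrow> bl y z \<Longrightarrow> bl z w \<Longrightarrow> bl w x \<Longrightarrow> x = z \<or> y = w" by (rule C4_free)
  show "bl b a" "bl a c" "bl b c" using tri sym by blast+
  show "\<And>L. set L \<subseteq> V \<Longrightarrow> cyclic_walk (\<lambda>x y. \<not> bl x y) L \<Longrightarrow> length L \<noteq> n" by (rule no_cycle)
qed (use V in simp_all)

lemmas walk_simps = successively_append_iff successively_Cons hd_append last_append hd_rev last_rev

lemma rev_walk:
  "successively (\<lambda>x y. \<not> bl x y) L \<Longrightarrow> successively (\<lambda>x y. \<not> bl y x) L"
  by (erule successively_mono) (simp add: sym)

text \<open>Crossing exchange on the red path \<open>b S a\<close>: if \<open>a u\<close> and
  \<open>b v\<close> were both red for consecutive \<open>u\<close>, \<open>v\<close>, then going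
  from \<open>b\<close> to \<open>u\<close>, over to \<open>a\<close>, back along \<open>S\<close>
  to \<open>v\<close> and home to \<open>b\<close> would be a red cycle on the same \<open>n\<close>
  vertices.\<close>

lemma adjacent_nbrs:
  assumes S: "successively (\<lambda>x y. \<not> bl x y) S" "distinct S" "set S \<subseteq> V - {a, b}"
    "\<not> bl b (hd S)" "\<not> bl a (last S)" "length S + 2 = n"
  shows "successively (\<lambda>u v. bl a u \<or> bl b v) S"
proof (rule ccontr)
  assume "\<not> ?thesis"
  then obtain X u v Y where X: "S = X @ u # v # Y" "\<not> bl a u" "\<not> bl b v"
    by (metis not_successively_split)
  show False
    by (rule no_walk[of "b # X @ u # a # rev (v # Y)"])
      (use S rev_walk[OF S(1)] X V neq sym[of _ a] sym[of _ b] in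
        \<open>auto simp: walk_simps split: if_splits\<close>)
qed

text \<open>If \<open>S\<close> misses \<open>c\<close>, the crossing exchange splits it as
  \<open>X x Y\<close> with blue neighbours of \<open>a\<close> in \<open>X\<close> and of
  \<open>b\<close> in \<open>Y\<close>. These two parts are red to each other and to
  \<open>c\<close>, which lets \<open>c\<close> take the place of \<open>a\<close> or
  \<open>b\<close>.\<close>

lemma cycle_contains_apex:
  assumes S: "successively (\<lambda>x y. \<not> bl x y) S" "distinct S" "set S \<subseteq> V - {a, b}"
    "\<not> bl b (hd S)" "\<not> bl a (last S)" "length S + 2 = n" and n: "n \<ge> 6"
  shows "c \<in> set S"
proof (rule ccontr)
  assume c: "c \<notin> set S"
  from S n have "S \<noteq> []" by auto
  have S3: "u \<noteq> a" "u \<noteq> b" "u \<noteq> c" if "u \<in> set S" for u using S(3) c that by auto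
  \<comment> \<open>Membership in \<open>S\<close> is carried along because disjointness of the blue
    neighbourhoods holds only outside the triangle.\<close>
  have "successively (\<lambda>u v. bl a u \<or> (bl b v \<and> v \<in> set S)) S"
    by (rule successively_mono[OF adjacent_nbrs[OF S(1-6)]]) auto
  then obtain X x Y where X: "S = X @ x # Y" "\<forall>u\<in>set X. bl a u" "\<not> bl a x"
      "\<forall>u\<in>set Y. bl b u \<and> u \<in> set S"
  proof (rule successively_disj_decomp)
    show "\<not> bl a u" if "bl b u \<and> u \<in> set S" for u
      using that S3 nbr_disjoint(1) by blast
  qed (use S \<open>S \<noteq> []\<close> in auto)
  have XY: "\<not> bl u v \<and> \<not> bl v u" if "u \<in> set X" "v \<in> set Y" for u v
    using nbr_joined(1)[of u v] S3 X that by (simp add: sym[of v u])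
  have Xb: "\<not> bl b u \<and> \<not> bl u b \<and> \<not> bl c u \<and> \<not> bl u c" if "u \<in> set X" for u
    using nbr_disjoint(1,2)[of u] S3 X that by (simp add: sym[of u])
  have Ya: "\<not> bl a u \<and> \<not> bl u a \<and> \<not> bl c u \<and> \<not> bl u c" if "u \<in> set Y" for u
    using nbr_disjoint(1,3)[of u] S3 X that sym[of u] by auto
  have ax: "\<not> bl x a" using X sym by blast
  have xV: "x \<noteq> a" "x \<noteq> b" "x \<noteq> c" using S3 X by auto
  have sub: "set X \<subseteq> V - {a,b,c}" "set Y \<subseteq> V - {a,b,c}" "x \<in> V"
    using S(3) X(1) c by auto
  have len: "length X + length Y + 3 = n"
    using S(6) X(1) by auto
  note facts = ax XY Xb Ya V neq xV
  show False
  \<comment> \<open>With two vertices in \<open>Y\<close>, \<open>c\<close> replaces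
    \<open>b\<close>: one vertex of \<open>Y\<close> leads from \<open>x\<close> to
    \<open>X\<close>, the others lead from \<open>c\<close> back to \<open>a\<close>.\<close>
  proof (cases "length Y \<ge> 2")
    case True
    then obtain y y' Y' where Y: "Y = y # y' # Y'"
      by (metis Suc_le_length_iff numeral_2_eq_2)
    note dist = S(2)[unfolded X(1) Y, simplified]
    note w = S(1)[unfolded X(1) Y, simplified walk_simps, simplified]
      and w' = rev_walk[OF S(1), unfolded X(1) Y, simplified walk_simps, simplified]
    have fY: "\<not> bl y u \<and> \<not> bl y' u \<and> \<not> bl u y \<and> \<not> bl u y'" if "u \<in> set X \<union> {a, c}" for u
      using that XY[of u y] XY[of u y'] Ya[of y] Ya[of y'] Y by auto
    show False
    proof (rule no_walk[of "a # x # y # rev X @ c # y' # Y'"])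
      show "successively (\<lambda>x y. \<not> bl x y) (a # x # y # rev X @ c # y' # Y')"
        using w w' by (auto simp add: walk_simps X facts fY)
      show "\<not> bl (last (a # x # y # rev X @ c # y' # Y')) (hd (a # x # y # rev X @ c # y' # Y'))"
        using Ya Y by (cases "Y' = []") (simp_all)
      show "distinct (a # x # y # rev X @ c # y' # Y')" using dist neq xV sub Y by auto
    qed (use V sub len Y in auto)
  next
    case False
    \<comment> \<open>Now \<open>c\<close> replaces \<open>a\<close>, and \<open>X\<close> is the
      part that gets split.\<close>
    then have "length X \<ge> 2" using S X n by auto
    then obtain y y' Y' where Y: "X = y # y' # Y'"
      by (metis Suc_le_length_iff numeral_2_eq_2)
    note dist = S(2)[unfolded X(1) Y, simplified]
    note w = S(1)[unfolded X(1) Y, simplified walk_simps, simplified]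
      and w' = rev_walk[OF S(1), unfolded X(1) Y, simplified walk_simps, simplified]
    have fY: "\<not> bl y u \<and> \<not> bl y' u \<and> \<not> bl u y \<and> \<not> bl u y'" if "u \<in> set Y \<union> {b, c}" for u
      using that XY[of y u] XY[of y' u] Xb[of y] Xb[of y'] Y by auto
    show False
    \<comment> \<open>If \<open>b x\<close> is blue, \<open>x\<close> is red to \<open>c\<close> and
      to all of \<open>X\<close> and can be placed inside; otherwise \<open>x\<close> closes the
      cycle at \<open>b\<close>.\<close>
    proof (cases "bl b x")
      case True
      then have *: "\<not> bl c x \<and> \<not> bl x c" using nbr_disjoint xV sym by blast
      have **: "\<not> bl u x \<and> \<not> bl x u" if "u \<in> set X" for u
        using nbr_joined(1)[of u x] X S3 that True by (simp add: sym[of x u])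
      show False
      proof (rule no_walk[of "b # y # c # x # Y @ y' # Y'"])
        show "successively (\<lambda>x y. \<not> bl x y) (b # y # c # x # Y @ y' # Y')"
          using w w' **[of y'] Y by (auto simp add: walk_simps X facts fY *)
        show "\<not> bl (last (b # y # c # x # Y @ y' # Y')) (hd (b # y # c # x # Y @ y' # Y'))"
          using Xb Y by (cases "Y' = []") (simp_all)
        show "distinct (b # y # c # x # Y @ y' # Y')" using dist neq xV sub Y by auto
      qed (use V sub len Y in auto)
    next
      case False
      then have "\<not> bl x b" using sym by blast
      show False
      proof (rule no_walk[of "b # y # c # Y @ y' # Y' @ [x]"])
        show "successively (\<lambda>x y. \<not> bl x y) (b # y # c # Y @ y' # Y' @ [x])"
          using w w' by (auto simp add: walk_simps X facts fY)
        show "distinct (b # y # c # Y @ y' # Y' @ [x])" using dist neq xV sub Y by auto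
      qed (use \<open>\<not> bl x b\<close> V sub len Y in auto)
    qed
  qed
qed

end

text \<open>The situation after recolouring \<open>ab\<close>: a cycle \<open>b S1 c S2 a\<close> that is red except for its closing
  edge \<open>ab\<close>.\<close>

locale cycle_through_triangle = C4_free_triangle +
  fixes S1 S2 :: "'a list"
  assumes walks: "successively (\<lambda>x y. \<not> bl x y) S1" "successively (\<lambda>x y. \<not> bl x y) S2"
    and distinct: "distinct (S1 @ S2)" and sub: "set S1 \<union> set S2 \<subseteq> V - {a, b, c}"
    and ne: "S1 \<noteq> []" "S2 \<noteq> []"
    and ends: "\<not> bl b (hd S1)" "\<not> bl c (last S1)" "\<not> bl c (hd S2)" "\<not> bl a (last S2)"
    and len: "length S1 + length S2 + 3 = n" "n \<ge> 6"
    and nbr_b: "\<exists>y\<in>V. y \<noteq> b \<and> y \<noteq> hd S1 \<and> \<not> bl b y"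
    and nbr_a: "\<exists>y\<in>V. y \<noteq> a \<and> y \<noteq> last S2 \<and> \<not> bl a y"
begin

text \<open>Reading \<open>b S1 c S2 a\<close> backwards exchanges \<open>a\<close> and
  \<open>b\<close>, so each one-sided result below also has a mirror image.\<close>

lemma mirror: "cycle_through_triangle bl V n b a c (rev S2) (rev S1)"
proof -
  interpret sw: C4_free_triangle bl V n b a c by (rule swap)
  show ?thesis
  proof
    show "successively (\<lambda>x y. \<not> bl x y) (rev S2)" "successively (\<lambda>x y. \<not> bl x y) (rev S1)"
      using walks[THEN rev_walk] by simp_all
  qed (use distinct sub ne ends len nbr_a nbr_b in \<open>auto simp: hd_rev last_rev\<close>)
qed

lemma ends': "\<not> bl (hd S1) b" "\<not> bl (last S1) c" "\<not> bl (hd S2) c" "\<not> bl (last S2) a"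
  using ends sym by blast+

lemmas rev_walks = walks[THEN rev_walk]

lemma outside: "u \<in> set S1 \<union> set S2 \<Longrightarrow> u \<in> V \<and> u \<noteq> a \<and> u \<noteq> b \<and> u \<noteq> c"
  using sub by auto

lemma nbr_b_facts:
  assumes "u \<in> set S1 \<union> set S2" "bl b u"
  shows "\<not> bl a u \<and> \<not> bl u a \<and> \<not> bl c u \<and> \<not> bl u c"
  using assms nbr_disjoint[of u] outside[of u] sym[of u] by auto

lemma nbr_a_facts:
  assumes "u \<in> set S1 \<union> set S2" "bl a u"
  shows "\<not> bl b u \<and> \<not> bl u b \<and> \<not> bl c u \<and> \<not> bl u c"
  using assms nbr_disjoint[of u] outside[of u] sym[of u] by auto

text \<open>Here a vertex off the cycle is needed. \<open>nbr_b\<close> supplies a red neighbour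
  \<open>y\<close> of \<open>b\<close> other than \<open>hd S1\<close>; all other vertices of the
  cycle are blue neighbours of \<open>b\<close> or \<open>b\<close> itself, so \<open>y\<close> is
  new. It replaces \<open>a\<close> or the last vertex of \<open>S2\<close>.\<close>

lemma exceptional_b:
  assumes B: "\<forall>u\<in>set (tl S1) \<union> set S2. bl b u"
  shows False
proof -
  obtain s1 T1 where S1: "S1 = s1 # T1" using ne by (cases S1) auto
  obtain T2 t2 where S2: "S2 = T2 @ [t2]" using ne by (cases S2 rule: rev_cases) auto
  obtain y where y: "y \<in> V" "y \<noteq> b" "y \<noteq> s1" "\<not> bl b y" using nbr_b S1 by auto
  have BT: "bl b u" if "u \<in> set T1 \<union> set T2 \<union> {t2}" for u using that B S1 S2 by auto
  have fT: "\<not> bl a u \<and> \<not> bl u a \<and> \<not> bl c u \<and> \<not> bl u c" if "u \<in> set T1 \<union> set T2 \<union> {t2}" for u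
    using that nbr_b_facts[of u] BT[of u] S1 S2 by auto
  have yb: "\<not> bl y b" using y sym by blast
  have yn: "y \<noteq> a" "y \<noteq> c" "y \<noteq> t2" "y \<notin> set T1" "y \<notin> set T2" "y \<notin> set S2" "y \<notin> set S1"
    using y tri sym BT S1 S2 by auto
  have dist: "distinct T1" "distinct T2" "s1 \<notin> set T1" "s1 \<notin> set T2" "s1 \<noteq> t2"
    "t2 \<notin> set T1" "t2 \<notin> set T2" "set T1 \<inter> set T2 = {}"
    using distinct S1 S2 by auto
  have out: "set T1 \<subseteq> V - {a,b,c}" "set T2 \<subseteq> V - {a,b,c}" "s1 \<in> V - {a,b,c}" "t2 \<in> V - {a,b,c}"
    using sub S1 S2 by auto
  have w: "successively (\<lambda>x y. \<not> bl x y) T1" "successively (\<lambda>x y. \<not> bl x y) T2"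
    "T1 \<noteq> [] \<Longrightarrow> \<not> bl s1 (hd T1)" "\<not> bl b s1"
    using walks ends by (auto simp: walk_simps S1 S2)
  show False
  proof (cases "bl y t2")
    \<comment> \<open>If \<open>y t2\<close> is red, \<open>y\<close> takes the place of
      \<open>a\<close>.\<close>
    case False
    show False
    proof (rule no_walk[of "b # S1 @ c # S2 @ [y]"])
      show "successively (\<lambda>x y. \<not> bl x y) (b # S1 @ c # S2 @ [y])"
        using walks ends ends' ne False sym[of y] by (cases "T2 = []") (simp_all add: walk_simps S2)
    qed (use y yb yn distinct outside V neq len in auto)
  next
    case True
    \<comment> \<open>Since \<open>t2\<close> is a blue neighbour of \<open>b\<close>, the blue edge
      \<open>y t2\<close> forces \<open>y\<close> to be red to \<open>a\<close> and
      \<open>c\<close>. From here on \<open>t2\<close> is dropped in favour of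
      \<open>y\<close>.\<close>
    have ya: "\<not> bl a y" "\<not> bl c y"
      using nbr_joined(1)[of y t2] nbr_joined(3)[of t2 y] BT[of t2] out True y yn sym by auto
    then have ya': "\<not> bl y a" "\<not> bl y c" using sym by blast+
    show False
    proof (cases "T2 = []")
      case False
      show False
      proof (rule no_walk[of "b # S1 @ c # T2 @ [a, y]"])
        show "successively (\<lambda>x y. \<not> bl x y) (b # S1 @ c # T2 @ [a, y])"
          using walks ends ends' ne False w ya fT by (simp add: walk_simps S2)
      qed (use y yb yn S1 S2 out dist V neq len in auto)
    next
      case T2: True
      \<comment> \<open>\<open>T1\<close> now has to separate \<open>a\<close> from
        \<open>c\<close>, whose edge is blue. At most one of them is blue to \<open>s1\<close>, and
        the other one is visited right after \<open>s1\<close>.\<close>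
      then have T1: "T1 \<noteq> []" using len S1 S2 by auto
      show False
      proof (cases "bl c s1")
        case False
        then have "\<not> bl s1 c" using sym by blast
        show False
        proof (rule no_walk[of "b # s1 # c # T1 @ [a, y]"])
          show "successively (\<lambda>x y. \<not> bl x y) (b # s1 # c # T1 @ [a, y])"
            using w ya fT T1 \<open>\<not> bl s1 c\<close> by (auto simp: walk_simps)
        qed (use y yb yn S1 S2 T2 out dist V neq len in auto)
      next
        case True
        then have "\<not> bl a s1" using nbr_disjoint(2) out by auto
        then have "\<not> bl s1 a" using sym by blast
        show False
        proof (rule no_walk[of "b # s1 # a # T1 @ [c, y]"])
          show "successively (\<lambda>x y. \<not> bl x y) (b # s1 # a # T1 @ [c, y])"
            using w ya fT T1 \<open>\<not> bl s1 a\<close> by (auto simp: walk_simps)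
        qed (use y yb yn S1 S2 T2 out dist V neq len in auto)
      qed
    qed
  qed
qed

lemma exceptional_a:
  assumes "\<forall>u\<in>set S1 \<union> set (butlast S2). bl a u"
  shows False
proof -
  interpret m: cycle_through_triangle bl V n b a c "rev S2" "rev S1" by (rule mirror)
  have "tl (rev S2) = rev (butlast S2)"
    using ne by (cases S2 rule: rev_cases) auto
  with assms show False by (intro m.exceptional_b) auto
qed

lemma adjacent:
  "successively (\<lambda>u v. bl a u \<or> bl b v) S1" "successively (\<lambda>u v. bl a u \<or> bl b v) S2"
proof -
  have "successively (\<lambda>u v. bl a u \<or> bl b v) (S1 @ c # S2)"
  proof (rule adjacent_nbrs)
    show "successively (\<lambda>x y. \<not> bl x y) (S1 @ c # S2)"
      using walks ne ends ends' by (simp add: walk_simps)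
  qed (use ends distinct sub ne V len neq in auto)
  then show "successively (\<lambda>u v. bl a u \<or> bl b v) S1" "successively (\<lambda>u v. bl a u \<or> bl b v) S2"
    by (auto simp: walk_simps)
qed

text \<open>If \<open>u\<close> in an edge \<open>u v\<close> were not a blue neighbour of
  \<open>a\<close>, then \<open>v\<close> would be one by assumption, and also one of
  \<open>b\<close> by \<open>adjacent\<close>, which is impossible.\<close>

lemma butlast_nbrs:
  assumes "successively (\<lambda>u v. bl a u \<or> bl a v) S" "S = S1 \<or> S = S2"
  shows "\<forall>u\<in>set (butlast S). bl a u"
proof -
  have "bl a (S ! i)" if "Suc i < length S" for i
  proof -
    have "bl a (S ! i) \<or> bl a (S ! Suc i)" using assms(1) that by (simp add: successively_conv_nth)
    moreover have "bl a (S ! i) \<or> bl b (S ! Suc i)"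
      using adjacent assms(2) that by (auto simp: successively_conv_nth)
    moreover have "S ! Suc i \<in> set S1 \<union> set S2" using that assms(2) nth_mem by blast
    ultimately show ?thesis using nbr_a_facts by blast
  qed
  then show ?thesis by (simp add: successively_butlast[symmetric] successively_conv_nth)
qed

lemma tl_nbrs:
  assumes "successively (\<lambda>u v. bl b u \<or> bl b v) S" "S = S1 \<or> S = S2"
  shows "\<forall>v\<in>set (tl S). bl b v"
proof -
  have "bl b (S ! Suc i)" if "Suc i < length S" for i
  proof -
    have "bl b (S ! i) \<or> bl b (S ! Suc i)" using assms(1) that by (simp add: successively_conv_nth)
    moreover have "bl a (S ! i) \<or> bl b (S ! Suc i)"
      using adjacent assms(2) that by (auto simp: successively_conv_nth)
    moreover have "S ! i \<in> set S1 \<union> set S2" using that assms(2) by (metis Suc_lessD UnCI nth_mem)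
    ultimately show ?thesis using nbr_a_facts by blast
  qed
  then show ?thesis by (simp add: successively_tl[symmetric] successively_conv_nth)
qed

text \<open>If \<open>b\<close> and the last vertex of \<open>S2\<close> are joined by a red edge, then \<open>b S1 c S2\<close> is a red cycle
  that lacks only \<open>a\<close>. If \<open>a\<close> cannot be inserted into an edge of \<open>S1\<close> or \<open>S2\<close>, then nearly all
  vertices are blue neighbours of \<open>a\<close>, which determines the cycle well enough.\<close>

lemma last_joined_b:
  assumes t2: "\<not> bl b (last S2)"
  shows False
proof -
  have t2': "\<not> bl (last S2) b" using t2 sym by blast
  have "successively (\<lambda>u v. bl a u \<or> bl a v) S1"
  proof (rule ccontr)
    assume "\<not> ?thesis"
    then obtain X u v Y where X: "S1 = X @ u # v # Y" "\<not> bl a u" "\<not> bl a v"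
      by (rule not_successively_split) auto
    have "\<not> bl u a" using X sym by blast
    show False
    proof (rule no_walk[of "b # X @ u # a # v # Y @ c # S2"])
      show "successively (\<lambda>x y. \<not> bl x y) (b # X @ u # a # v # Y @ c # S2)"
        using walks ends ends' ne X \<open>\<not> bl u a\<close> by (auto simp: walk_simps split: if_splits)
    qed (use X t2' distinct sub ne V len neq in auto)
  qed
  then have A1: "\<forall>u\<in>set (butlast S1). bl a u" using butlast_nbrs by blast
  have "successively (\<lambda>u v. bl a u \<or> bl a v) S2"
  proof (rule ccontr)
    assume "\<not> ?thesis"
    then obtain X u v Y where X: "S2 = X @ u # v # Y" "\<not> bl a u" "\<not> bl a v"
      by (rule not_successively_split) auto
    have "\<not> bl u a" using X sym by blast
    show False
    proof (rule no_walk[of "b # S1 @ c # X @ u # a # v # Y"])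
      show "successively (\<lambda>x y. \<not> bl x y) (b # S1 @ c # X @ u # a # v # Y)"
        using walks ends ends' ne X \<open>\<not> bl u a\<close> by (auto simp: walk_simps split: if_splits)
    qed (use X t2' distinct sub ne V len neq in \<open>auto split: if_splits\<close>)
  qed
  then have A2: "\<forall>u\<in>set (butlast S2). bl a u" using butlast_nbrs by blast
  obtain P1 x where S1: "S1 = P1 @ [x]" using ne by (cases S1 rule: rev_cases) auto
  obtain P2 y where S2: "S2 = P2 @ [y]" using ne by (cases S2 rule: rev_cases) auto
  \<comment> \<open>Otherwise every outside vertex of the cycle except \<open>y\<close> would be a
    blue neighbour of \<open>a\<close>, which \<open>exceptional_a\<close> excludes.\<close>
  have x: "\<not> bl a x"
    using exceptional_a A1 A2 S1 by auto
  then have x': "\<not> bl x a" using sym by blast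
  have P: "bl a u" "\<not> bl b u \<and> \<not> bl u b \<and> \<not> bl c u \<and> \<not> bl u c" if "u \<in> set P1 \<union> set P2" for u
    using that A1 A2 S1 S2 nbr_a_facts[of u] by auto
  have w: "successively (\<lambda>x y. \<not> bl x y) P1" "successively (\<lambda>x y. \<not> bl x y) P2"
    "successively (\<lambda>x y. \<not> bl y x) P1" "successively (\<lambda>x y. \<not> bl y x) P2"
    "P1 \<noteq> [] \<Longrightarrow> \<not> bl (last P1) x" "P2 \<noteq> [] \<Longrightarrow> \<not> bl y (last P2)"
    "\<not> bl c x" "\<not> bl x c" "\<not> bl a y" "\<not> bl y a" "\<not> bl b y" "\<not> bl y b"
    using walks rev_walks ends ends' t2 t2' by (auto simp: walk_simps S1 S2)
  have d: "distinct P1" "distinct P2" "set P1 \<inter> set P2 = {}" "x \<noteq> y" "x \<notin> set P1 \<union> set P2"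
    "y \<notin> set P1 \<union> set P2" using distinct S1 S2 by auto
  have out: "set P1 \<subseteq> V - {a,b,c}" "set P2 \<subseteq> V - {a,b,c}" "x \<in> V - {a,b,c}" "y \<in> V - {a,b,c}"
    using sub S1 S2 by auto
  show False
  \<comment> \<open>\<open>P1\<close> and \<open>P2\<close> are red to \<open>b\<close> and
    \<open>c\<close>, while \<open>x\<close> and \<open>y\<close> are red to \<open>a\<close>, so
    the pieces fit around \<open>x a y\<close>. A non-empty \<open>P1\<close> separates
    \<open>b\<close> from \<open>c\<close>.\<close>
  proof (cases "P1 = []")
    case False
    show False
    proof (rule no_walk[of "b # P1 @ c # x # a # y # rev P2"])
      show "successively (\<lambda>x y. \<not> bl x y) (b # P1 @ c # x # a # y # rev P2)"
        using w P x' False by (auto simp: walk_simps)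
      show "\<not> bl (last (b # P1 @ c # x # a # y # rev P2)) (hd (b # P1 @ c # x # a # y # rev P2))"
        using w P by (auto simp: last_rev)
    qed (use d out V len neq S1 S2 in auto)
  next
    case True
    then have P2: "P2 \<noteq> []" using len S1 S2 by auto
    \<comment> \<open>With \<open>P1\<close> empty, \<open>x\<close> is \<open>hd S1\<close> and
      thus red to \<open>b\<close>; \<open>P2\<close> takes over the separation of \<open>b\<close>
      from \<open>c\<close>.\<close>
    have bx: "\<not> bl b x" "\<not> bl x b" using ends ends' S1 True by auto
    show False
    proof (cases "bl c y")
      case False
      then have "\<not> bl y c" using sym by blast
      show False
      proof (rule no_walk[of "b # x # a # y # c # rev P2"])
        show "successively (\<lambda>x y. \<not> bl x y) (b # x # a # y # c # rev P2)"
          using w P bx x' P2 \<open>\<not> bl y c\<close> by (auto simp: walk_simps)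
        show "\<not> bl (last (b # x # a # y # c # rev P2)) (hd (b # x # a # y # c # rev P2))"
          using P P2 by (auto simp: last_rev)
      qed (use d out V len neq S1 S2 True in auto)
    next
      case cy: True
      show False
      proof (rule no_walk[of "a # x # c # P2 @ [b, y]"])
        show "successively (\<lambda>x y. \<not> bl x y) (a # x # c # P2 @ [b, y])"
          using w P x P2 by (auto simp: walk_simps)
      qed (use w d out V len neq S1 S2 True in auto)
    qed
  qed
qed

text \<open>This is the case in which \<open>b\<close> fits into no edge of \<open>S1\<close> or
  \<open>S2\<close>; \<open>tl_nbrs\<close> then provides \<open>B\<close>. The blue neighbours of
  \<open>b\<close> are red to \<open>a\<close> and \<open>c\<close>, and the cycle is rebuilt around
  the red path from \<open>hd S1\<close> over \<open>b\<close> to \<open>hd S2\<close>.\<close>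

lemma no_insertion_b:
  assumes s1: "bl a (hd S1)" and t2: "bl b (last S2)"
    and B: "\<forall>u\<in>set (tl S1). bl b u" "\<forall>u\<in>set (tl S2). bl b u"
  shows False
proof -
  obtain s1 T1 where S1: "S1 = s1 # T1" using ne by (cases S1) auto
  obtain s2 T2 where S2: "S2 = s2 # T2" using ne by (cases S2) auto
  have s2: "\<not> bl b s2" using exceptional_b B S2 by auto
  have T2: "T2 \<noteq> []" using s2 t2 S2 by auto
  have BT: "\<not> bl a u \<and> \<not> bl u a \<and> \<not> bl c u \<and> \<not> bl u c" if "u \<in> set T1 \<union> set T2" for u
    using that nbr_b_facts[of u] B S1 S2 by auto
  have s1': "\<not> bl b s1 \<and> \<not> bl s1 b \<and> \<not> bl c s1 \<and> \<not> bl s1 c"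
    using nbr_a_facts[of s1] s1 S1 by auto
  have w: "successively (\<lambda>x y. \<not> bl x y) T1" "successively (\<lambda>x y. \<not> bl x y) T2"
    "\<not> bl s2 (hd T2)"
    using walks T2 by (auto simp: walk_simps S1 S2)
  have d: "distinct T1" "distinct T2" "set T1 \<inter> set T2 = {}" "s1 \<noteq> s2" "s1 \<notin> set T1 \<union> set T2"
    "s2 \<notin> set T1 \<union> set T2" using distinct S1 S2 by auto
  have out: "set T1 \<subseteq> V - {a,b,c}" "set T2 \<subseteq> V - {a,b,c}" "s1 \<in> V - {a,b,c}" "s2 \<in> V - {a,b,c}"
    using sub S1 S2 by auto
  show False
  proof (cases "T1 = []")
    case False
    show False
    proof (rule no_walk[of "s1 # b # s2 # T2 @ a # T1 @ [c]"])
      show "successively (\<lambda>x y. \<not> bl x y) (s1 # b # s2 # T2 @ a # T1 @ [c])"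
        using w s1' s2 T2 False BT by (auto simp: walk_simps)
    qed (use s1' d out V len neq S1 S2 in auto)
  next
    case T1: True
    show False
    \<comment> \<open>\<open>a\<close> has to be placed next to \<open>T2\<close>: directly after
      \<open>s2\<close> if that edge is red, otherwise one vertex later.\<close>
    proof (cases "bl a s2")
      case False
      then have "\<not> bl s2 a" using sym by blast
      show False
      proof (rule no_walk[of "s1 # b # s2 # a # T2 @ [c]"])
        show "successively (\<lambda>x y. \<not> bl x y) (s1 # b # s2 # a # T2 @ [c])"
          using w s1' s2 T2 \<open>\<not> bl s2 a\<close> BT by (auto simp: walk_simps)
      qed (use s1' d out V len neq S1 S2 T1 in auto)
    next
      case True
      obtain z T where z: "T2 = z # T" using T2 by (cases T2) auto
      \<comment> \<open>For empty \<open>T\<close>, all outside vertices but the last one,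
        \<open>z\<close>, would be blue neighbours of \<open>a\<close>, contrary to
        \<open>exceptional_a\<close>.\<close>
      have "T \<noteq> []" using exceptional_a s1 True S1 S2 T1 z by auto
      show False
      proof (rule no_walk[of "s1 # b # s2 # z # a # T @ [c]"])
        show "successively (\<lambda>x y. \<not> bl x y) (s1 # b # s2 # z # a # T @ [c])"
          using w s1' s2 z \<open>T \<noteq> []\<close> BT by (auto simp: walk_simps)
      qed (use s1' d out V len neq S1 S2 T1 z in auto)
    qed
  qed
qed

text \<open>\<open>hd (Z @ [w])\<close> is the successor of \<open>u\<close>. This form includes
  \<open>Z = []\<close>, where the two edges used for the insertions share the vertex
  \<open>w\<close>.\<close>

lemma insert_two:
  assumes L: "cyclic_walk (\<lambda>x y. \<not> bl x y) (X @ u # Z @ w # w' # Y)"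
    and len: "length (X @ u # Z @ w # w' # Y) + 2 = n" "set (X @ u # Z @ w # w' # Y) \<subseteq> V - {p, q}"
    and pq: "p \<noteq> q" "p \<in> V" "q \<in> V"
    and p: "\<not> bl p u" "\<not> bl p (hd (Z @ [w]))" and q: "\<not> bl q w" "\<not> bl q w'"
  shows False
proof (rule no_walk[of "X @ u # p # Z @ w # q # w' # Y"])
  show "successively (\<lambda>x y. \<not> bl x y) (X @ u # p # Z @ w # q # w' # Y)"
    using L p q sym[of _ p] sym[of _ q] by (cases Z) (auto simp: walk_simps cyclic_walk_def)
  show "\<not> bl (last (X @ u # p # Z @ w # q # w' # Y)) (hd (X @ u # p # Z @ w # q # w' # Y))"
    using L by (cases X) (auto simp: cyclic_walk_def)
qed (use L len pq in \<open>auto simp: cyclic_walk_def\<close>)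

lemma contradiction: False
proof -
  interpret m: cycle_through_triangle bl V n b a c "rev S2" "rev S1" by (rule mirror)
  have t2: "bl b (last S2)" using last_joined_b by blast
  have s1: "bl a (hd S1)" using m.last_joined_b by (auto simp: last_rev)
  have closed: "\<not> bl (last S2) (hd S1)"
    using nbr_joined(1)[of "hd S1" "last S2"] s1 t2 outside[of "hd S1"] outside[of "last S2"] ne sym
    by auto
  \<comment> \<open>By \<open>closed\<close>, \<open>S1 c S2\<close> is a red cycle; \<open>a\<close> and \<open>b\<close> are to be inserted into two different edges.\<close>
  define L where "L = S1 @ c # S2"
  have cyc: "cyclic_walk (\<lambda>x y. \<not> bl x y) L"
    unfolding cyclic_walk_def L_def using closed walks ne ends ends' distinct sub
    by (auto simp: walk_simps)
  have L: "set L \<subseteq> V - {a, b}" "length L + 2 = n" using sub V neq len by (auto simp: L_def)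
  have in_L: "\<exists>X Y. L = X @ u # v # Y" if "S1 = X @ u # v # Y \<or> S2 = X @ u # v # Y" for X u v Y
    using that unfolding L_def by (metis append.assoc append_Cons)
  \<comment> \<open>An edge that can receive \<open>b\<close>; without one, \<open>tl_nbrs\<close>
    leads to the situation of \<open>no_insertion_b\<close>. The edge for \<open>a\<close> comes
    from the mirror image.\<close>
  have "\<exists>u v X Y. (S1 = X @ u # v # Y \<or> S2 = X @ u # v # Y) \<and> \<not> bl b u \<and> \<not> bl b v"
  proof (rule ccontr)
    assume *: "\<not> ?thesis"
    have "successively (\<lambda>u v. bl b u \<or> bl b v) S" if "S = S1 \<or> S = S2" for S
      using that * not_successively_split[of "\<lambda>u v. bl b u \<or> bl b v" S] by metis
    then show False using no_insertion_b[OF s1 t2] tl_nbrs by blast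
  qed
  moreover have "\<exists>u v X Y. (S1 = X @ u # v # Y \<or> S2 = X @ u # v # Y) \<and> \<not> bl a u \<and> \<not> bl a v"
  proof (rule ccontr)
    assume *: "\<not> ?thesis"
    have "successively (\<lambda>u v. bl a u \<or> bl a v) S" if "S = S1 \<or> S = S2" for S
      using that * not_successively_split[of "\<lambda>u v. bl a u \<or> bl a v" S] by metis
    then have "\<forall>u\<in>set (butlast S1). bl a u" "\<forall>u\<in>set (butlast S2). bl a u"
      using butlast_nbrs by blast+
    moreover have "tl (rev S) = rev (butlast S)" for S :: "'a list" by (cases S rule: rev_cases) auto
    ultimately show False using m.no_insertion_b s1 t2 by (simp add: hd_rev last_rev)
  qed
  ultimately obtain u v X Y w w' X' Y' where
    u: "S1 = X @ u # v # Y \<or> S2 = X @ u # v # Y" "\<not> bl b u" "\<not> bl b v" and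
    w: "S1 = X' @ w # w' # Y' \<or> S2 = X' @ w # w' # Y'" "\<not> bl a w" "\<not> bl a w'"
    by blast
  \<comment> \<open>The two edges differ: as \<open>b v\<close> is red, \<open>adjacent\<close>
    makes \<open>a u\<close> blue, whereas \<open>a w\<close> is red.\<close>
  have "bl a u \<or> bl b v"
    using u(1) adjacent by (elim disjE) (simp_all add: successively_append_iff)
  then have "u \<noteq> w" using u(3) w(2) by blast
  obtain X Y X' Y' where Lu: "L = X @ u # v # Y" and Lw: "L = X' @ w # w' # Y'"
    using in_L[OF u(1)] in_L[OF w(1)] by blast
  then have "X @ u # v # Y = X' @ w # w' # Y'" by simp
  \<comment> \<open>Comparing the two decompositions of \<open>L\<close> tells which of the two
    edges comes first.\<close>
  then obtain us where "X = X' @ us \<and> us @ u # v # Y = w # w' # Y' \<or>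
      X @ us = X' \<and> u # v # Y = us @ w # w' # Y'"
    unfolding append_eq_append_conv2 by blast
  then have "\<exists>Z. X' = X @ u # Z \<and> v # Y = Z @ w # w' # Y' \<or>
      X = X' @ w # Z \<and> w' # Y' = Z @ u # v # Y"
    using \<open>u \<noteq> w\<close> by (cases us) auto
  then show False
  proof (elim exE disjE conjE)
    fix Z assume Z: "X' = X @ u # Z" "v # Y = Z @ w # w' # Y'"
    then have "v = hd (Z @ [w])" by (cases Z) auto
    then have v: "\<not> bl b (hd (Z @ [w]))" using u(3) by simp
    have L': "L = X @ u # Z @ w # w' # Y'" using Lw Z by simp
    show False
      by (rule insert_two[of X u Z w w' Y' b a, folded L'])
        (use cyc L V neq u(2) v w(2,3) in auto)
  next
    fix Z assume Z: "X = X' @ w # Z" "w' # Y' = Z @ u # v # Y"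
    then have "w' = hd (Z @ [u])" by (cases Z) auto
    then have v: "\<not> bl a (hd (Z @ [u]))" using w(3) by simp
    have L': "L = X' @ w # Z @ u # v # Y" using Lu Z by simp
    show False
      by (rule insert_two[of X' w Z u v Y a b, folded L'])
        (use cyc L V neq u(2,3) v w(2) in auto)
  qed
qed

end

text \<open>This is what remains of a red cycle of length \<open>n\<close> created by recolouring
  \<open>x y\<close>. The path runs from \<open>y\<close> to \<open>x\<close>, matching the
  orientation \<open>b S1 c S2 a\<close>, and \<open>S\<close> is its interior.\<close>

definition closing_path :: "('a \<Rightarrow> 'a \<Rightarrow> bool) \<Rightarrow> 'a set \<Rightarrow> nat \<Rightarrow> 'a \<Rightarrow> 'a \<Rightarrow> 'a list \<Rightarrow> bool"
  where "closing_path bl V n x y S \<longleftrightarrow> successively (\<lambda>u v. \<not> bl u v) S \<and> distinct S \<and>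
    set S \<subseteq> V - {x, y} \<and> \<not> bl y (hd S) \<and> \<not> bl x (last S) \<and> length S + 2 = n"

lemma (in C4_free_triangle) closing_path_split:
  assumes S: "closing_path bl V n a b S" and n: "n \<ge> 6"
  obtains S1 S2 where "S = S1 @ c # S2" "S1 \<noteq> []" "S2 \<noteq> []" "\<not> bl c (last S1)" "\<not> bl c (hd S2)"
proof -
  from S n have "c \<in> set S"
    by (intro cycle_contains_apex) (auto simp: closing_path_def)
  then obtain S1 S2 where S12: "S = S1 @ c # S2" by (meson split_list)
  \<comment> \<open>\<open>c\<close> is blue to \<open>a\<close> and \<open>b\<close>, so it cannot
    be an end of \<open>S\<close>.\<close>
  have ne: "S1 \<noteq> []" "S2 \<noteq> []"
    using S tri S12 by (auto simp: closing_path_def)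
  have "\<not> bl (last S1) c" "\<not> bl c (hd S2)"
    using S S12 ne by (auto simp: closing_path_def walk_simps)
  then show ?thesis using that[OF S12 ne] sym by blast
qed

text \<open>The predecessor and successor of \<open>c\<close> on the path are distinct red
  neighbours of \<open>c\<close>, and at most one of them equals \<open>z\<close>.\<close>

lemma (in C4_free_triangle) apex_nbrs:
  assumes S: "closing_path bl V n a b S" and n: "n \<ge> 6"
  shows "\<exists>y\<in>V. y \<noteq> c \<and> y \<noteq> z \<and> \<not> bl c y"
proof -
  obtain S1 S2 where S12: "S = S1 @ c # S2" "S1 \<noteq> []" "S2 \<noteq> []" "\<not> bl c (last S1)" "\<not> bl c (hd S2)"
    by (rule closing_path_split[OF S n])
  have l: "last S1 \<in> set S1" "hd S2 \<in> set S2" using S12 by auto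
  then have "last S1 \<in> V" "hd S2 \<in> V" "last S1 \<noteq> c" "hd S2 \<noteq> c" "last S1 \<noteq> hd S2"
    using S S12(1) by (auto simp: closing_path_def)
  with S12 show ?thesis by metis
qed

text \<open>The three paths may belong to different lengths in \<open>N\<close>, hence three
  instances of the locale. The path for \<open>a b\<close> gives the cycle to be rerouted; those for
  \<open>b c\<close> and \<open>c a\<close> pass through \<open>a\<close> and \<open>b\<close> and
  supply their further red neighbours.\<close>

lemma closing_paths_contradiction:
  assumes sym: "\<And>x y. bl x y \<longleftrightarrow> bl y x" and irrefl: "\<And>x. \<not> bl x x"
    and C4_free: "\<And>x y z w. bl x y \<Longrightarrow> bl y z \<Longrightarrow> bl z w \<Longrightarrow> bl w x \<Longrightarrow> x = z \<or> y = w"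
    and tri: "bl a b" "bl b c" "bl c a" and V: "a \<in> V" "b \<in> V" "c \<in> V"
    and no_cycle: "\<And>n L. n \<in> N \<Longrightarrow> set L \<subseteq> V \<Longrightarrow> cyclic_walk (\<lambda>x y. \<not> bl x y) L \<Longrightarrow> length L \<noteq> n"
    and N: "\<And>n. n \<in> N \<Longrightarrow> n \<ge> 6"
    and paths: "\<And>x y. (x, y) \<in> {(a, b), (b, c), (c, a)} \<Longrightarrow> \<exists>n\<in>N. \<exists>S. closing_path bl V n x y S"
  shows False
proof -
  have loc: "C4_free_triangle bl V n x y z"
    if "n \<in> N" "bl x y" "bl y z" "bl z x" "x \<in> V" "y \<in> V" "z \<in> V" for n x y z
  proof
    show "\<And>x y. bl x y = bl y x" by (rule sym)
    show "\<And>x y z w. bl x y \<Longrightarrow> bl y z \<Longrightarrow> bl z w \<Longrightarrow> bl w x \<Longrightarrow> x = z \<or> y = w" by (rule C4_free)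
    show "\<And>L. set L \<subseteq> V \<Longrightarrow> cyclic_walk (\<lambda>x y. \<not> bl x y) L \<Longrightarrow> length L \<noteq> n"
      by (rule no_cycle[OF that(1)])
    show "bl x z" using that sym by blast
  qed (use that irrefl in simp_all)
  obtain n S where S: "n \<in> N" "closing_path bl V n a b S" using paths by blast
  obtain n1 T1 where T1: "n1 \<in> N" "closing_path bl V n1 b c T1" using paths by blast
  obtain n2 T2 where T2: "n2 \<in> N" "closing_path bl V n2 c a T2" using paths by blast
  interpret A: C4_free_triangle bl V n a b c using loc S tri V by blast
  interpret B: C4_free_triangle bl V n1 b c a using loc T1 tri V by blast
  interpret C: C4_free_triangle bl V n2 c a b using loc T2 tri V by blast
  obtain S1 S2 where S12: "S = S1 @ c # S2" "S1 \<noteq> []" "S2 \<noteq> []" "\<not> bl c (last S1)" "\<not> bl c (hd S2)"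
    by (rule A.closing_path_split[OF S(2) N[OF S(1)]])
  have "cycle_through_triangle bl V n a b c S1 S2"
  proof
    show "\<exists>y\<in>V. y \<noteq> b \<and> y \<noteq> hd S1 \<and> \<not> bl b y"
      by (rule C.apex_nbrs[OF T2(2) N[OF T2(1)]])
    show "\<exists>y\<in>V. y \<noteq> a \<and> y \<noteq> last S2 \<and> \<not> bl a y"
      by (rule B.apex_nbrs[OF T1(2) N[OF T1(1)]])
    show "successively (\<lambda>x y. \<not> bl x y) S1" "successively (\<lambda>x y. \<not> bl x y) S2"
      using S(2) S12(1) by (auto simp: closing_path_def successively_append_iff successively_Cons)
  qed (use S S12 N[OF S(1)] in \<open>auto simp: closing_path_def\<close>)
  then show False by (rule cycle_through_triangle.contradiction)
qed

text \<open>As \<open>L\<close> is not red throughout, it uses the edge \<open>a b\<close>. A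
  rotation, followed by a reversal if necessary, makes this the closing edge, and distinctness keeps
  all other steps away from it.\<close>

lemma closing_path_if_recoloured:
  assumes sym: "\<And>x y. bl x y \<longleftrightarrow> bl y x" and "a \<noteq> b"
    and L: "cyclic_walk (\<lambda>x y. \<not> bl x y \<or> {x, y} = {a, b}) L" "set L \<subseteq> V" "length L \<ge> 3"
    and no: "\<not> cyclic_walk (\<lambda>x y. \<not> bl x y) L"
  shows "\<exists>S. closing_path bl V (length L) a b S"
proof -
  let ?r = "\<lambda>x y. \<not> bl x y \<or> {x, y} = {a, b}"
  have "\<exists>S u v. cyclic_walk ?r (v # S @ [u]) \<and> bl u v \<and> set (v # S @ [u]) = set L \<and> length (v # S @ [u]) = length L"
  proof (cases "bl (last L) (hd L)")
    case True
    obtain v L' where L': "L = v # L'" "L' \<noteq> []" using L(3) by (cases L; force)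
    moreover from L'(2) have "L' = butlast L' @ [last L']" by simp
    ultimately have "L = v # butlast L' @ [last L']" by simp
    then obtain S u where "L = v # S @ [u]" by blast
    then show ?thesis using True L(1) by (intro exI[of _ S] exI[of _ u] exI[of _ v]) auto
  next
    case False
    with no L(1) have "\<not> successively (\<lambda>x y. \<not> bl x y) L" by (auto simp: cyclic_walk_def)
    then obtain X u v Y where X: "L = X @ u # v # Y" "bl u v"
      by (rule not_successively_split) auto
    then have "cyclic_walk ?r ((v # Y) @ (X @ [u]))"
      using L(1) cyclic_walk_rotate[of ?r "X @ [u]" "v # Y"] by simp
    with X show ?thesis by (intro exI[of _ "Y @ X"] exI[of _ u] exI[of _ v]) auto
  qed
  then obtain S u v where S: "cyclic_walk ?r (v # S @ [u])" "bl u v" "set (v # S @ [u]) = set L"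
    "length (v # S @ [u]) = length L" by blast
  have uv: "u = a \<and> v = b \<or> u = b \<and> v = a"
    using S(1,2) by (auto simp: cyclic_walk_def doubleton_eq_iff)
  have "\<exists>S. cyclic_walk ?r (b # S @ [a]) \<and> set (b # S @ [a]) = set L \<and> length (b # S @ [a]) = length L"
    using uv
  proof
    assume "u = b \<and> v = a"
    moreover have "cyclic_walk ?r (rev (v # S @ [u]))"
      using S(1) sym by (subst cyclic_walk_rev) (auto simp: insert_commute)
    ultimately show ?thesis using S by (intro exI[of _ "rev S"]) auto
  qed (use S in auto)
  then obtain S where S: "cyclic_walk ?r (b # S @ [a])" "set (b # S @ [a]) = set L"
    "length (b # S @ [a]) = length L" by blast
  have ne: "S \<noteq> []" using S(3) L(3) by auto
  have d: "distinct S" "a \<notin> set S" "b \<notin> set S" using S(1) by (auto simp: cyclic_walk_def)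
  have s: "successively ?r S" "?r b (hd S)" "?r (last S) a"
    using S(1) ne by (auto simp: cyclic_walk_def successively_append_iff successively_Cons)
  have "successively (\<lambda>x y. \<not> bl x y) S"
    by (rule successively_mono[OF s(1)]) (use d in \<open>auto simp: doubleton_eq_iff\<close>)
  moreover have "\<not> bl b (hd S)" "\<not> bl a (last S)"
    using s(2,3) d hd_in_set[OF ne] last_in_set[OF ne] sym[of a "last S"]
    by (auto simp: doubleton_eq_iff)
  ultimately show ?thesis
    using d S(2,3) L(2) by (intro exI[of _ S]) (auto simp: closing_path_def)
qed

section \<open>Cycles in graphs\<close>

lemma graph_iso_sym:
  assumes "graph_iso G H"
  shows "graph_iso H G"
proof -
  obtain f where f: "bij_betw f (verts G) (verts H)" "(\<lambda>e. f ` e) ` edges G = edges H"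
    and s: "simple_graph G" "simple_graph H"
    using assms by (auto simp: graph_iso_def)
  let ?g = "inv_into (verts G) f"
  have "?g ` f ` e = e" if "e \<in> edges G" for e
  proof (rule inv_into_image_cancel)
    show "inj_on f (verts G)" using f(1) by (simp add: bij_betw_def)
    show "e \<subseteq> verts G" using that s(1) by (auto simp: simple_graph_def nsets_def)
  qed
  then have "(\<lambda>e. ?g ` e) ` edges H = edges G"
    unfolding f(2)[symmetric] by (simp add: image_image)
  with f(1) s show ?thesis
    unfolding graph_iso_def by (metis bij_betw_inv_into)
qed

lemma graph_iso_trans:
  assumes "graph_iso G H" "graph_iso H K"
  shows "graph_iso G K"
proof -
  obtain f where f: "bij_betw f (verts G) (verts H)" "(\<lambda>e. f ` e) ` edges G = edges H"
    using assms by (auto simp: graph_iso_def)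
  obtain g where g: "bij_betw g (verts H) (verts K)" "(\<lambda>e. g ` e) ` edges H = edges K"
    using assms by (auto simp: graph_iso_def)
  have "(\<lambda>e. (g \<circ> f) ` e) ` edges G = edges K"
    unfolding g(2)[symmetric] f(2)[symmetric] by (simp add: image_image image_comp)
  with bij_betw_trans[OF f(1) g(1)] assms show ?thesis
    unfolding graph_iso_def by blast
qed

lemma graph_iso_card_edges:
  assumes "graph_iso G H"
  shows "card (edges G) = card (edges H)"
proof -
  obtain f where f: "bij_betw f (verts G) (verts H)" "(\<lambda>e. f ` e) ` edges G = edges H"
    and s: "simple_graph G"
    using assms by (auto simp: graph_iso_def)
  have "inj_on (\<lambda>e. f ` e) (Pow (verts G))"
    using f(1) by (auto simp: bij_betw_def intro: inj_on_image_Pow)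
  moreover have "edges G \<subseteq> Pow (verts G)"
    using s by (auto simp: simple_graph_def nsets_def)
  ultimately have "inj_on (\<lambda>e. f ` e) (edges G)" by (rule inj_on_subset)
  then show ?thesis using f(2) card_image by metis
qed

lemma is_cycle_iso:
  assumes "is_cycle H"
  shows "cycle_length H \<ge> 3" "graph_iso H (cycle_graph (cycle_length H))"
proof -
  obtain k where k: "k \<ge> 3" "graph_iso H (cycle_graph k)" using assms by (auto simp: is_cycle_def)
  then have "cycle_length H = k"
    using graph_iso_card_edges cycle_length_cycle_graph unfolding cycle_length_def by metis
  with k show "cycle_length H \<ge> 3" "graph_iso H (cycle_graph (cycle_length H))" by auto
qed

text \<open>This links isomorphic copies to vertex lists: \<open>L\<close> lists the images of the
  vertices \<open>0\<close> to \<open>k - 1\<close>.\<close>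

lemma contains_cycle_graph_iff:
  assumes k: "k \<ge> 3" and G: "simple_graph G"
  shows "(\<exists>S. subgraph S G \<and> graph_iso S (cycle_graph k)) \<longleftrightarrow>
    (\<exists>L. set L \<subseteq> verts G \<and> length L = k \<and> cyclic_walk (\<lambda>x y. {x, y} \<in> edges G) L)"
proof
  assume "\<exists>S. subgraph S G \<and> graph_iso S (cycle_graph k)"
  then obtain S where S: "subgraph S G" "graph_iso (cycle_graph k) S"
    using graph_iso_sym by blast
  then obtain f where f: "bij_betw f {..<k} (verts S)" "(\<lambda>e. f ` e) ` edges (cycle_graph k) = edges S"
    by (auto simp: graph_iso_def cycle_graph_def)
  define L where "L = map f [0..<k]"
  have "distinct L" using f(1) by (auto simp: L_def distinct_map bij_betw_def lessThan_atLeast0)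
  moreover have "{L ! i, L ! (Suc i mod length L)} \<in> edges G" if "i < length L" for i
  proof -
    have "{i, Suc i mod k} \<in> edges (cycle_graph k)" using that by (auto simp: cycle_graph_def L_def)
    then have "f ` {i, Suc i mod k} \<in> edges S" unfolding f(2)[symmetric] by (rule imageI)
    then have "f ` {i, Suc i mod k} \<in> edges G" using S(1) by (auto simp: subgraph_def)
    then show ?thesis using that k by (simp add: L_def)
  qed
  ultimately have "cyclic_walk (\<lambda>x y. {x, y} \<in> edges G) L"
    using k by (subst cyclic_walk_conv_nth) (auto simp: L_def)
  moreover have "set L \<subseteq> verts G"
    using f(1) S(1) by (auto simp: L_def bij_betw_def subgraph_def lessThan_atLeast0)
  ultimately show "\<exists>L. set L \<subseteq> verts G \<and> length L = k \<and> cyclic_walk (\<lambda>x y. {x, y} \<in> edges G) L"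
    by (intro exI[of _ L]) (auto simp: L_def)
next
  assume "\<exists>L. set L \<subseteq> verts G \<and> length L = k \<and> cyclic_walk (\<lambda>x y. {x, y} \<in> edges G) L"
  then obtain L where L: "set L \<subseteq> verts G" "length L = k" "cyclic_walk (\<lambda>x y. {x, y} \<in> edges G) L"
    by blast
  then have "L \<noteq> []" using k by auto
  then have d: "distinct L" and e: "\<And>i. i < k \<Longrightarrow> {L ! i, L ! (Suc i mod k)} \<in> edges G"
    using L by (simp_all add: cyclic_walk_conv_nth)
  define S where "S = (set L, (\<lambda>e. (!) L ` e) ` edges (cycle_graph k))"
  have ES: "edges S = (\<lambda>i. {L ! i, L ! (Suc i mod k)}) ` {..<k}"
  proof -
    have "edges (cycle_graph k) = (\<lambda>i. {i, Suc i mod k}) ` {..<k}"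
      by (auto simp: cycle_graph_def)
    then show ?thesis by (simp add: S_def image_image)
  qed
  have sG: "edges S \<subseteq> edges G" using e ES by auto
  have "e \<in> [set L]\<^bsup>2\<^esup>" if "e \<in> edges S" for e
  proof -
    have "e \<in> edges G" using that sG by blast
    then have "card e = 2" "finite e" using G by (auto simp: simple_graph_def nsets_def)
    moreover have "Suc i mod k < length L" for i using k L(2) by simp
    then have "e \<subseteq> set L" using that L(2) unfolding ES by auto
    ultimately show ?thesis by (simp add: nsets_def)
  qed
  then have S: "simple_graph S" by (auto simp: simple_graph_def S_def)
  then have "subgraph S G" using G L(1) sG by (auto simp: subgraph_def S_def)
  moreover have "graph_iso (cycle_graph k) S"
    unfolding graph_iso_def
  proof (intro conjI exI[of _ "(!) L"])
    show "bij_betw ((!) L) (verts (cycle_graph k)) (verts S)"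
      using d L(2) by (auto simp: S_def cycle_graph_def intro: bij_betw_nth)
  qed (use S k in \<open>auto simp: S_def simple_graph_cycle_graph\<close>)
  ultimately show "\<exists>S. subgraph S G \<and> graph_iso S (cycle_graph k)"
    using graph_iso_sym by blast
qed

text \<open>A cycle is determined up to isomorphism by its number of edges, so only the lengths in
  the family matter.\<close>

lemma has_subgraph_from_cycles_iff:
  assumes G: "simple_graph G" and cyc: "\<forall>H\<in>\<G>. is_cycle H"
  shows "has_subgraph_from G \<G> \<longleftrightarrow> (\<exists>H\<in>\<G>. \<exists>L. set L \<subseteq> verts G \<and> length L = cycle_length H \<and>
    cyclic_walk (\<lambda>x y. {x, y} \<in> edges G) L)"
proof -
  have "graph_iso S H \<longleftrightarrow> graph_iso S (cycle_graph (cycle_length H))" if "H \<in> \<G>" for S :: "'a graph" and H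
  proof -
    have "graph_iso H (cycle_graph (cycle_length H))" using that cyc is_cycle_iso(2) by blast
    from graph_iso_trans[of S, OF _ this] graph_iso_trans[of S, OF _ graph_iso_sym[OF this]]
    show ?thesis by blast
  qed
  then have "has_subgraph_from G \<G> \<longleftrightarrow>
    (\<exists>H\<in>\<G>. \<exists>S. subgraph S G \<and> graph_iso S (cycle_graph (cycle_length H)))"
    unfolding has_subgraph_from_def by blast
  also have "\<dots> \<longleftrightarrow> (\<exists>H\<in>\<G>. \<exists>L. set L \<subseteq> verts G \<and> length L = cycle_length H \<and>
    cyclic_walk (\<lambda>x y. {x, y} \<in> edges G) L)"
    using contains_cycle_graph_iff[OF _ G] is_cycle_iso(1) cyc by (intro bex_cong refl) blast
  finally show ?thesis .
qed

lemma has_subgraph_from_mono: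
  assumes "has_subgraph_from (V, E) \<G>" "E \<subseteq> E'" "simple_graph (V, E')"
  shows "has_subgraph_from (V, E') \<G>"
proof -
  obtain S H where "subgraph S (V, E)" "H \<in> \<G>" "graph_iso S H"
    using assms(1) by (auto simp: has_subgraph_from_def)
  moreover from this have "subgraph S (V, E')" using assms(2,3) by (auto simp: subgraph_def)
  ultimately show ?thesis unfolding has_subgraph_from_def by blast
qed

lemma has_subgraph_from_Un:
  "has_subgraph_from G (\<G> \<union> \<H>) \<longleftrightarrow> has_subgraph_from G \<G> \<or> has_subgraph_from G \<H>"
  unfolding has_subgraph_from_def by blast


section \<open>Ramsey numbers\<close>

lemma ramsey_property_without_triangle:
  fixes \<Gamma>1 \<Gamma>2 :: "nat graph set"
  assumes G1: "\<forall>G\<in>\<Gamma>1. is_cycle G \<and> cycle_length G \<ge> 6"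
    and P: "ramsey_property \<Gamma>1 ({cycle_graph 3, cycle_graph 4} \<union> \<Gamma>2) N"
  shows "ramsey_property \<Gamma>1 ({cycle_graph 4} \<union> \<Gamma>2) N"
proof (rule ccontr)
  assume "\<not> ?thesis"
  then obtain V :: "nat set" and R0 B0 where rb0: "red_blue_graph V R0 B0" "card V = N"
    "\<not> has_subgraph_from (V, R0) \<Gamma>1" "\<not> has_subgraph_from (V, B0) ({cycle_graph 4} \<union> \<Gamma>2)"
    unfolding ramsey_property_def by blast
  define E where "E = [V]\<^bsup>2\<^esup>"
  \<comment> \<open>A colouring is represented by its blue edges alone, with red as the complement
    in \<open>E\<close>, so that \<open>card\<close> can be minimised.\<close>
  define bad where "bad B \<longleftrightarrow> B \<subseteq> E \<and> \<not> has_subgraph_from (V, E - B) \<Gamma>1 \<and>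
    \<not> has_subgraph_from (V, B) ({cycle_graph 4} \<union> \<Gamma>2)" for B
  have fin: "finite V" and "R0 = E - B0" "B0 \<subseteq> E"
    using rb0(1) by (auto simp: red_blue_graph_def E_def)
  then have "bad B0" using rb0 by (simp add: bad_def)
  then obtain B where B: "bad B" and min: "\<And>B'. bad B' \<Longrightarrow> card B \<le> card B'"
    using ex_has_least_nat[of bad B0 card] by blast
  have BE: "B \<subseteq> E" and noR: "\<not> has_subgraph_from (V, E - B) \<Gamma>1"
    and noB: "\<not> has_subgraph_from (V, B) ({cycle_graph 4} \<union> \<Gamma>2)"
    using B by (auto simp: bad_def)
  have finE: "finite E" using fin by (simp add: E_def finite_imp_finite_nsets)
  have simple: "simple_graph (V, F)" if "F \<subseteq> E" for F
    using that fin by (simp add: simple_graph_def E_def)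
  define bl where "bl x y \<longleftrightarrow> {x, y} \<in> B" for x y
  have sym: "bl x y \<longleftrightarrow> bl y x" for x y by (simp add: bl_def insert_commute)
  have E: "{x, y} \<in> E \<longleftrightarrow> x \<in> V \<and> y \<in> V \<and> x \<noteq> y" for x y
    by (auto simp: E_def)
  have irrefl: "\<not> bl x x" for x using BE E[of x x] by (auto simp: bl_def)
  have blV: "x \<in> V" "y \<in> V" if "bl x y" for x y using that BE E[of x y] by (auto simp: bl_def)
  have C4: "x = z \<or> y = w" if "bl x y" "bl y z" "bl z w" "bl w x" for x y z w
  proof (rule ccontr)
    assume "\<not> ?thesis"
    then have "cyclic_walk (\<lambda>x y. {x, y} \<in> B) [x, y, z, w]"
      using that irrefl by (auto simp: cyclic_walk_def bl_def)
    moreover have "set [x, y, z, w] \<subseteq> V" using that blV by auto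
    moreover have "length [x, y, z, w] = 4" by simp
    ultimately have "\<exists>L. set L \<subseteq> verts (V, B) \<and> length L = 4 \<and> cyclic_walk (\<lambda>x y. {x, y} \<in> edges (V, B)) L"
      by (metis fst_conv snd_conv)
    then have "has_subgraph_from (V, B) {cycle_graph 4}"
      using contains_cycle_graph_iff[of 4, OF _ simple[OF BE]] by (auto simp: has_subgraph_from_def)
    then show False using noB has_subgraph_from_Un by metis
  qed
  have "red_blue_graph V (E - B) B"
    using fin BE by (auto simp: red_blue_graph_def E_def)
  \<comment> \<open>\<open>P\<close> applies to the minimal colouring, whose only possible blue
    subgraph from the larger family is a triangle.\<close>
  then have "has_subgraph_from (V, B) ({cycle_graph 3, cycle_graph 4} \<union> \<Gamma>2)"
    using P rb0(2) noR unfolding ramsey_property_def by blast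
  moreover have "{cycle_graph 3, cycle_graph 4} \<union> \<Gamma>2 = {cycle_graph 3} \<union> ({cycle_graph 4} \<union> \<Gamma>2)"
    by auto
  ultimately have "has_subgraph_from (V, B) {cycle_graph 3}"
    using noB has_subgraph_from_Un by metis
  then have "\<exists>S. subgraph S (V, B) \<and> graph_iso S (cycle_graph 3)"
    unfolding has_subgraph_from_def by blast
  then obtain L where L: "length L = 3" "cyclic_walk (\<lambda>x y. {x, y} \<in> B) L"
    using contains_cycle_graph_iff[of 3, OF _ simple[OF BE]] by auto
  then obtain a b c where "L = [a, b, c]"
    by (auto simp: length_Suc_conv numeral_3_eq_3)
  with L have tri: "bl a b" "bl b c" "bl c a" by (auto simp: cyclic_walk_def bl_def)
  \<comment> \<open>Consecutive entries of a distinct list in \<open>V\<close> of length at least 6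
    are joined by an edge of \<open>E\<close>, so red may be read as not blue.\<close>
  have red: "has_subgraph_from (V, E - B') \<Gamma>1 \<longleftrightarrow>
      (\<exists>H\<in>\<Gamma>1. \<exists>L. set L \<subseteq> V \<and> length L = cycle_length H \<and> cyclic_walk (\<lambda>x y. {x, y} \<notin> B') L)" for B'
  proof -
    have "cyclic_walk (\<lambda>x y. {x, y} \<in> E - B') L \<longleftrightarrow> cyclic_walk (\<lambda>x y. {x, y} \<notin> B') L"
      if "set L \<subseteq> V" "length L \<ge> 6" for L
    proof -
      have "L \<noteq> []" using that by auto
      have "L ! j \<in> V" if "j < length L" for j
        using that \<open>set L \<subseteq> V\<close> nth_mem by blast
      moreover have "Suc i mod length L < length L" "i \<noteq> Suc i mod length L" if "i < length L" for i
        using that \<open>length L \<ge> 6\<close> by (auto simp: mod_Suc)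
      ultimately have "{L ! i, L ! (Suc i mod length L)} \<in> E" if "distinct L" "i < length L" for i
        using that by (simp add: E nth_eq_iff_index_eq)
      then show ?thesis
        using \<open>L \<noteq> []\<close> by (auto simp: cyclic_walk_conv_nth)
    qed
    then have "(\<exists>H\<in>\<Gamma>1. \<exists>L. set L \<subseteq> V \<and> length L = cycle_length H \<and>
        cyclic_walk (\<lambda>x y. {x, y} \<in> E - B') L) \<longleftrightarrow>
      (\<exists>H\<in>\<Gamma>1. \<exists>L. set L \<subseteq> V \<and> length L = cycle_length H \<and> cyclic_walk (\<lambda>x y. {x, y} \<notin> B') L)"
      using G1 by (metis (no_types, lifting))
    moreover have "simple_graph (V, E - B')" "\<forall>G\<in>\<Gamma>1. is_cycle G"
      using simple[of "E - B'"] G1 by auto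
    ultimately show ?thesis by (simp add: has_subgraph_from_cycles_iff)
  qed
  show False
  proof (rule closing_paths_contradiction[of bl a b c V "cycle_length ` \<Gamma>1"])
    show "\<exists>n\<in>cycle_length ` \<Gamma>1. \<exists>S. closing_path bl V n x y S"
      if "(x, y) \<in> {(a, b), (b, c), (c, a)}" for x y
    proof -
      have xy: "bl x y" using that tri by auto
      then have "{x, y} \<in> B" by (simp add: bl_def)
      then have "card (B - {{x, y}}) < card B"
        using finE BE by (meson card_Diff1_less finite_subset)
      \<comment> \<open>Recolouring \<open>x y\<close> red lowers the number of blue edges and
        creates no blue subgraph, so by minimality it must create a red cycle.\<close>
      then have "\<not> bad (B - {{x, y}})" using min by (metis leD)
      moreover have "\<not> has_subgraph_from (V, B - {{x, y}}) ({cycle_graph 4} \<union> \<Gamma>2)"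
        using noB has_subgraph_from_mono[OF _ _ simple[OF BE]] by blast
      ultimately have "has_subgraph_from (V, E - (B - {{x, y}})) \<Gamma>1"
        using BE by (auto simp: bad_def)
      then obtain H L where H: "H \<in> \<Gamma>1" and L: "set L \<subseteq> V" "length L = cycle_length H"
        "cyclic_walk (\<lambda>u v. {u, v} \<notin> B - {{x, y}}) L"
        unfolding red by blast
      have "\<exists>S. closing_path bl V (length L) x y S"
      proof (rule closing_path_if_recoloured)
        show "x \<noteq> y" using xy irrefl by auto
        show "cyclic_walk (\<lambda>u v. \<not> bl u v \<or> {u, v} = {x, y}) L" using L(3) by (simp add: bl_def)
        show "length L \<ge> 3" using L(2) H G1 by fastforce
        show "\<not> cyclic_walk (\<lambda>x y. \<not> bl x y) L" using noR red[of B] H L(1,2) by (auto simp: bl_def)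
      qed (use sym L in auto)
      then show ?thesis using H L(2) by auto
    qed
    show "length L \<noteq> n" if "n \<in> cycle_length ` \<Gamma>1" "set L \<subseteq> V" "cyclic_walk (\<lambda>x y. \<not> bl x y) L" for n L
      using that noR red[of B] by (auto simp: bl_def)
  qed (use sym irrefl C4 tri blV G1 in blast)+
qed

lemma ramsey_property_mono:
  assumes "ramsey_property \<G> \<H> N" "\<H> \<subseteq> \<H>'"
  shows "ramsey_property \<G> \<H>' N"
proof -
  have "has_subgraph_from G \<H>'" if "has_subgraph_from G \<H>" for G :: "nat graph"
    using that assms(2) unfolding has_subgraph_from_def by blast
  then show ?thesis using assms(1) unfolding ramsey_property_def by blast
qed

theorem corollary1p10:
  shows "(\<forall>(\<Gamma>\<^sub>1 :: nat graph set) (\<Gamma>\<^sub>2 :: nat graph set).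
            \<Gamma>\<^sub>1 \<noteq> {} \<and> (\<forall>G\<in>\<Gamma>\<^sub>1. is_cycle G) \<and>
            (\<forall>G\<in>\<Gamma>\<^sub>2. is_cycle G \<and> cycle_length G \<ge> 5) \<and>
            (\<forall>G\<in>\<Gamma>\<^sub>1. cycle_length G \<ge> 6) \<longrightarrow>
            ramsey_number \<Gamma>\<^sub>1 ({cycle_graph 4} \<union> \<Gamma>\<^sub>2) =
            ramsey_number \<Gamma>\<^sub>1 ({cycle_graph 3, cycle_graph 4} \<union> \<Gamma>\<^sub>2)) \<and>
         (\<forall>n\<ge>6. ramsey_number {cycle_graph n} {cycle_graph 4} =
                  ramsey_number {cycle_graph n} {cycle_graph 3, cycle_graph 4})"
proof -
  have *: "ramsey_number \<Gamma>1 ({cycle_graph 4} \<union> \<Gamma>2) = ramsey_number \<Gamma>1 ({cycle_graph 3, cycle_graph 4} \<union> \<Gamma>2)"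
    if "\<forall>G\<in>\<Gamma>1. is_cycle G \<and> cycle_length G \<ge> 6" for \<Gamma>1 \<Gamma>2 :: "nat graph set"
  proof -
    \<comment> \<open>Both numbers are \<open>LEAST\<close> of the same predicate once the two
      properties agree for every \<open>N\<close>.\<close>
    have "ramsey_property \<Gamma>1 ({cycle_graph 4} \<union> \<Gamma>2) =
        ramsey_property \<Gamma>1 ({cycle_graph 3, cycle_graph 4} \<union> \<Gamma>2)"
    proof (intro ext iffI)
      show "ramsey_property \<Gamma>1 ({cycle_graph 3, cycle_graph 4} \<union> \<Gamma>2) N"
        if "ramsey_property \<Gamma>1 ({cycle_graph 4} \<union> \<Gamma>2) N" for N
        using that by (rule ramsey_property_mono) auto
    qed (rule ramsey_property_without_triangle[OF that])
    then show ?thesis by (simp add: ramsey_number_def)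
  qed
  moreover have "\<forall>G\<in>{cycle_graph n}. is_cycle G \<and> cycle_length G \<ge> 6" if "n \<ge> 6" for n
    using that by (simp add: is_cycle_cycle_graph cycle_length_cycle_graph)
  ultimately show ?thesis
    using *[of "{cycle_graph _}" "{}"] by simp
qed

end
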